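(* Let $Q$ be a quiver and let $\sigma$ and $\sigma'$ be two cyclic orderings of the vertices of $Q$. The following are equivalent: (1) the cyclically ordered quivers $(Q,\sigma)$ and $(Q,\sigma')$ are wiggle equivalent; (2) for any cycle $C$ in the undirected simple graph $K_Q$ (equipped with a distinguished direction of traversal), we have $\operatorname{wind}(C,\sigma)=\operatorname{wind}(C,\sigma')$.
   Context: A quiver is a finite directed graph without loops or oriented 2-cycles; multiple arrows are allowed; vertices are labeled. $K_Q$ denotes the underlying undirected simple graph of $Q$ (ignoring orientations and multiplicities). A cyclic ordering $\sigma=(v_1,\dots,v_n)$ of the vertex set is a linear ordering $v_1<\dots<v_n$ considered up to cyclic shifts (a "clockwise" placement of the vertices on a circle). A cyclically ordered quiver (COQ) $(Q,\sigma)$ is a quiver $Q$ together with a cyclic ordering $\sigma$ of its vertices. A wiggle transforms $(Q,\sigma)$ into $(Q,\sigma')$ where $\sigma'$ is obtained from $\sigma$ by interchanging two vertices that are consecutive in $\sigma$ and are not adjacent in $Q$ (no arrows between them). Two COQs are wiggle equivalent if they are related by a sequence of wiggles. Winding numbers: let $n$ be the number of vertices. For a cyclic ordering $\sigma=(v_1,\dots,v_n)$ and $a=v_i$, $b=v_j$, set $\theta(\sigma,a,b)=j-i$ if $i\le j$ and $\theta(\sigma,a,b)=n+j-i$ if $i>j$. For a cycle $C=(u_0-u_1-\cdots-u_{k-1}-u_k=u_0)$ in $K_Q$ with the chosen direction of traversal ($u_{i+1}$ follows $u_i$), let $\ell$ be the number of indices $i\in\{0,\dots,k-1\}$ such that $Q$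 contains an arrow $u_i\leftarrow u_{i+1}$. Then $$\operatorname{wind}(C,\sigma)=\frac1n\Bigl(\sum_{0\le i\le k-1}\theta(\sigma,u_i,u_{i+1})\Bigr)-\ell .$$ *)

theory Defs
  imports
    Complex_Main
    "Graph_Theory.Graph_Theory"
    "HOL-Combinatorics.Multiset_Permutations"
begin

text \<open>Arcs are individual objects with a tail and a head, so multiple arrows are allowed.\<close>

locale quiver = fin_digraph Q + loopfree_digraph Q
  for Q :: "('a, 'b) pre_digraph" +
  assumes no_2_cycles: "u \<rightarrow>\<^bsub>Q\<^esub> v \<Longrightarrow> \<not> v \<rightarrow>\<^bsub>Q\<^esub> u"

text \<open>
  Following the convention of the graph library, the simple undirected graph is
  represented by the symmetric digraph without multiple arcs on the same vertices.
\<close>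

definition underlying_graph :: "('a, 'b) pre_digraph \<Rightarrow> ('a, 'a \<times> 'a) pre_digraph" where
  "underlying_graph Q = with_proj (mk_symmetric Q)"

text \<open>
  A cycle with a direction of traversal, given as \<open>[u\<^sub>0, \<dots>, u\<^sub>k\<^sub>-\<^sub>1]\<close> (the final
  \<open>u\<^sub>k = u\<^sub>0\<close> is not repeated).  The library notion of a cycle in a digraph is not used
  since in a symmetric digraph it would admit \<open>u, v, u\<close>.
\<close>

definition undirected_cycle :: "('a, 'b) pre_digraph \<Rightarrow> 'a list \<Rightarrow> bool" where
  "undirected_cycle G us \<longleftrightarrow> 3 \<le> length us \<and> vpath us G \<and> last us \<rightarrow>\<^bsub>G\<^esub> hd us"

text \<open>A cyclic ordering is a class of linear orderings (lists without repetition)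
  modulo cyclic shifts.\<close>

definition cyclic_shift :: "('a list \<times> 'a list) set" where
  "cyclic_shift = {(xs, ys). \<exists>k. ys = rotate k xs}"

definition cyclic_orderings :: "'a set \<Rightarrow> 'a list set set" where
  "cyclic_orderings V = permutations_of_set V // cyclic_shift"

text \<open>
  Two vertices are consecutive in a cyclic ordering iff some representative starts with them;
  this includes the pair formed by the last and the first entry of a representative.
\<close>

definition wiggle :: "('a, 'b) pre_digraph \<Rightarrow> 'a list set \<Rightarrow> 'a list set \<Rightarrow> bool" where
  "wiggle Q \<sigma> \<sigma>' \<longleftrightarrow>
     \<sigma> \<in> cyclic_orderings (verts Q) \<and> \<sigma>' \<in> cyclic_orderings (verts Q) \<and>
     (\<exists>a b xs. a # b # xs \<in> \<sigma> \<and> b # a # xs \<in> \<sigma>' \<and> \<not> a \<rightarrow>\<^bsub>underlying_graph Q\<^esub> b)"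

definition wiggle_equivalent :: "('a, 'b) pre_digraph \<Rightarrow> 'a list set \<Rightarrow> 'a list set \<Rightarrow> bool" where
  "wiggle_equivalent Q = (wiggle Q)\<^sup>*\<^sup>*"

text \<open>Positions count from 0; only differences of positions matter below.\<close>

definition position :: "'a list \<Rightarrow> 'a \<Rightarrow> nat" where
  "position xs a = (THE i. i < length xs \<and> xs ! i = a)"

definition theta_list :: "'a list \<Rightarrow> 'a \<Rightarrow> 'a \<Rightarrow> nat" where
  "theta_list xs a b =
     (let i = position xs a; j = position xs b
      in if i \<le> j then j - i else length xs + j - i)"

text \<open>The common value on all representatives; see \<open>theta_eq_theta_list\<close> below.\<close>

definition theta :: "'a list set \<Rightarrow> 'a \<Rightarrow> 'a \<Rightarrow> nat" where
  "theta \<sigma> a b = the_elem (\<Union>xs\<in>\<sigma>. {theta_list xs a b})"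

definition wind :: "('a, 'b) pre_digraph \<Rightarrow> 'a list \<Rightarrow> 'a list set \<Rightarrow> rat" where
  "wind Q us \<sigma> =
     (let n = card (verts Q); k = length us;
          u = (\<lambda>i. us ! (i mod k));
          l = card {i. i < k \<and> u (i + 1) \<rightarrow>\<^bsub>Q\<^esub> u i}
      in 1 / of_nat n * of_nat (\<Sum>i<k. theta \<sigma> (u i) (u (i + 1))) - of_nat l)"

lemma position_eqI:
  assumes "distinct xs" "i < length xs" "xs ! i = a"
  shows "position xs a = i"
  unfolding position_def using assms by (auto intro!: the_equality simp: nth_eq_iff_index_eq)

lemma position_less_length_and_nth:
  assumes "distinct xs" "a \<in> set xs"
  shows "position xs a < length xs \<and> xs ! position xs a = a"
  using assms by (metis in_set_conv_nth position_eqI)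

lemma theta_list_eq_mod:
  assumes "distinct xs" "a \<in> set xs" "b \<in> set xs"
  shows "int (theta_list xs a b) =
    (int (position xs b) - int (position xs a)) mod int (length xs)"
proof -
  define i j n where "i = position xs a" and "j = position xs b" and "n = length xs"
  have ij: "i < n" "j < n"
    using assms position_less_length_and_nth unfolding i_def j_def n_def by metis+
  show ?thesis
  proof (cases "i \<le> j")
    case True
    then have "(int j - int i) mod int n = int j - int i"
      using ij by (intro mod_pos_pos_trivial) auto
    with True show ?thesis
      by (simp add: theta_list_def i_def j_def n_def)
  next
    case False
    have "(int j - int i) mod int n = (int j - int i + int n) mod int n" by simp
    also have "\<dots> = int j - int i + int n"
      using ij False by (intro mod_pos_pos_trivial) auto
    finally show ?thesis using ij False
      by (simp add: theta_list_def i_def j_def n_def)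
  qed
qed

lemma theta_list_rotate:
  assumes "distinct xs" "a \<in> set xs" "b \<in> set xs"
  shows "theta_list (rotate k xs) a b = theta_list xs a b"
proof -
  have pos: "position xs c = (k + position (rotate k xs) c) mod length xs" if "c \<in> set xs" for c
  proof (rule position_eqI)
    have *: "position (rotate k xs) c < length xs" "rotate k xs ! position (rotate k xs) c = c"
      using position_less_length_and_nth[of "rotate k xs" c] assms(1) that by auto
    then show "(k + position (rotate k xs) c) mod length xs < length xs"
      by (intro mod_less_divisor) linarith
    show "xs ! ((k + position (rotate k xs) c) mod length xs) = c"
      using * nth_rotate[of "position (rotate k xs) c" xs k] by simp
  qed (fact assms)
  have "int (theta_list xs a b) = int (theta_list (rotate k xs) a b)"
    using assms by (simp add: theta_list_eq_mod pos of_nat_mod mod_diff_eq)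
  then show ?thesis by simp
qed

lemma theta_eq_theta_list:
  assumes "\<sigma> \<in> cyclic_orderings V" "xs \<in> \<sigma>" "a \<in> V" "b \<in> V"
  shows "theta \<sigma> a b = theta_list xs a b"
proof -
  obtain zs where zs: "distinct zs" "set zs = V" "\<sigma> = cyclic_shift `` {zs}"
    using assms(1) by (auto simp: cyclic_orderings_def quotient_def permutations_of_set_def)
  have *: "theta_list ys a b = theta_list zs a b" if "ys \<in> \<sigma>" for ys
    using that zs assms by (auto simp: cyclic_shift_def theta_list_rotate)
  have "(\<Union>ys\<in>\<sigma>. {theta_list ys a b}) = {theta_list xs a b}"
    using * assms(2) by auto
  then show ?thesis by (simp add: theta_def)
qed

end

theory Submission
  imports Defs
begin

text \<open>
  The sum of \<open>\<theta>\<close> along a cycle telescopes to \<open>n\<close> times the number of descents, so up to a term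
  independent of the ordering the winding number counts the edges traversed against a linear
  representative. If two representatives have the same number of descents on every cycle, then the
  difference of their descent indicators is the difference of a potential \<open>h\<close> on the
  vertices. A vertex maximizing \<open>h\<close> can be moved to the end of the first representative by wiggles
  and a rotation, which lowers \<open>h\<close> there by one; once \<open>h = 0\<close>, both representatives are
  linear extensions of the same acyclic orientation.
\<close>

section \<open>Sums along cycles and potentials\<close>

definition path_sum :: "('a \<Rightarrow> 'a \<Rightarrow> 'c::comm_monoid_add) \<Rightarrow> 'a list \<Rightarrow> 'c" where
  "path_sum g us = (\<Sum>(u, v)\<leftarrow>vwalk_arcs us. g u v)"

text \<open>A cycle is a list that does not repeat its starting vertex at the end, so the closing
  edge enters as a separate summand.\<close>

definition cycle_sum :: "('a \<Rightarrow> 'a \<Rightarrow> 'c::comm_monoid_add) \<Rightarrow> 'a list \<Rightarrow> 'c" where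
  "cycle_sum g us = path_sum g us + g (last us) (hd us)"

lemma path_sum_simps [simp]:
  "path_sum g [] = 0"
  "path_sum g [u] = 0"
  "path_sum g (u # v # us) = g u v + path_sum g (v # us)"
  by (simp_all add: path_sum_def)

lemma path_sum_nth: "path_sum g us = (\<Sum>i<length us - 1. g (us ! i) (us ! Suc i))"
proof (induction us rule: vwalk_arcs.induct)
  case (3 u v us)
  then show ?case
    by (simp add: sum.lessThan_Suc_shift del: sum.lessThan_Suc)
qed auto

text \<open>Links the recursive form, suited to induction along walks, to the indices modulo the
  length in which \<open>wind\<close> is written.\<close>

lemma cycle_sum_nth:
  assumes "us \<noteq> []"
  shows "(\<Sum>i<length us. g (us ! i) (us ! ((i + 1) mod length us))) = cycle_sum g us"
proof -
  obtain n where n: "length us = Suc n"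
    using assms by (cases us) auto
  show ?thesis
    using assms by (simp add: n cycle_sum_def path_sum_nth last_conv_nth hd_conv_nth)
qed

lemma path_sum_cong:
  assumes "\<And>u v. (u, v) \<in> set (vwalk_arcs us) \<Longrightarrow> g u v = g' u v"
  shows "path_sum g us = path_sum g' us"
  unfolding path_sum_def using assms by (intro arg_cong[where f = sum_list] map_cong) auto

lemma cycle_sum_cong:
  assumes "\<And>u v. (u, v) \<in> insert (last us, hd us) (set (vwalk_arcs us)) \<Longrightarrow> g u v = g' u v"
  shows "cycle_sum g us = cycle_sum g' us"
  unfolding cycle_sum_def using assms path_sum_cong[of us g g'] by auto

lemma path_sum_diff:
  fixes g :: "'a \<Rightarrow> 'a \<Rightarrow> 'c::ab_group_add"
  shows "path_sum (\<lambda>u v. g u v - g' u v) us = path_sum g us - path_sum g' us"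
  by (induction us rule: vwalk_arcs.induct) auto

lemma cycle_sum_diff:
  fixes g :: "'a \<Rightarrow> 'a \<Rightarrow> 'c::ab_group_add"
  shows "cycle_sum (\<lambda>u v. g u v - g' u v) us = cycle_sum g us - cycle_sum g' us"
  by (simp add: cycle_sum_def path_sum_diff)

lemma path_sum_potential:
  fixes h :: "'a \<Rightarrow> 'c::ab_group_add"
  assumes "us \<noteq> []"
  shows "path_sum (\<lambda>u v. h v - h u) us = h (last us) - h (hd us)"
  using assms by (induction us rule: vwalk_arcs.induct) auto

lemma rtrancl_imp_distinct_path:
  assumes "(a, b) \<in> E\<^sup>*"
  obtains p where "p \<noteq> []" "hd p = a" "last p = b" "distinct p" "set (vwalk_arcs p) \<subseteq> E"
proof -
  from assms have "\<exists>p. p \<noteq> [] \<and> hd p = a \<and> last p = b \<and> distinct p \<and> set (vwalk_arcs p) \<subseteq> E"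
  proof (induction rule: converse_rtrancl_induct)
    case base
    show ?case by (intro exI[of _ "[b]"]) auto
  next
    case (step x y)
    then obtain p where p: "p \<noteq> []" "hd p = y" "last p = b" "distinct p" "set (vwalk_arcs p) \<subseteq> E"
      by blast
    show ?case
    proof (cases "x \<in> set p")
      \<comment> \<open>A path already through \<open>x\<close> is cut down to its suffix from
        \<open>x\<close>, which is still distinct.\<close>
      case True
      then obtain q r where qr: "p = q @ x # r" by (auto simp: in_set_conv_decomp)
      then have "set (vwalk_arcs (x # r)) \<subseteq> E"
        using p(5) set_vwalk_arcs_append2[of "x # r" q] by auto
      then show ?thesis using p qr by (intro exI[of _ "x # r"]) auto
    next
      case False
      then show ?thesis using p step by (intro exI[of _ "x # p"]) auto
    qed
  qed
  then show ?thesis using that by blast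
qed

text \<open>Induction on the number of edges: remove an edge between \<open>a\<close> and
  \<open>b\<close> in both directions and take a potential of the rest. If \<open>b\<close> is still
  reachable from \<open>a\<close>, a distinct path closes up to a cycle whose vanishing sum forces
  the right difference on the removed edge. Otherwise the potential is shifted on the component of
  \<open>a\<close>. Antisymmetry of \<open>f\<close> settles the reversed edge.\<close>

lemma conservative_imp_potential:
  fixes f :: "'a \<Rightarrow> 'a \<Rightarrow> 'c::ab_group_add"
  assumes "finite E" "sym E" "irrefl E"
    and "\<And>u v. (u, v) \<in> E \<Longrightarrow> f v u = - f u v"
    and "\<And>us. \<lbrakk>3 \<le> length us; distinct us; set (vwalk_arcs us) \<subseteq> E; (last us, hd us) \<in> E\<rbrakk>
      \<Longrightarrow> cycle_sum f us = 0"
  shows "\<exists>h. \<forall>(u, v)\<in>E. f u v = h v - h u"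
  using assms
proof (induction "card E" arbitrary: E rule: less_induct)
  case (less E)
  show ?case
  proof (cases "E = {}")
    case False
    then obtain a b where ab: "(a, b) \<in> E" by auto
    then have ba: "(b, a) \<in> E" and "a \<noteq> b"
      using less.prems(2,3) by (auto simp: sym_def irrefl_def)
    define E' where "E' = E - {(a, b), (b, a)}"
    have sub: "E' \<subseteq> E" and "E' \<subset> E" using ab by (auto simp: E'_def)
    have sym': "sym E'" using less.prems(2) by (auto simp: E'_def sym_def)
    have "\<exists>h. \<forall>(u, v)\<in>E'. f u v = h v - h u"
    proof (rule less.hyps)
      show "card E' < card E"
        using \<open>E' \<subset> E\<close> less.prems(1) by (intro psubset_card_mono)
      show "finite E'" using sub less.prems(1) by (rule finite_subset)
      show "irrefl E'" using less.prems(3) sub by (auto simp: irrefl_def)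
      show "sym E'" by fact
      show "f v u = - f u v" if "(u, v) \<in> E'" for u v
        using that sub less.prems(4) by blast
      show "cycle_sum f us = 0" if "3 \<le> length us" "distinct us" "set (vwalk_arcs us) \<subseteq> E'"
        "(last us, hd us) \<in> E'" for us
        using that sub by (intro less.prems(5)) auto
    qed
    then obtain h where h: "\<And>u v. (u, v) \<in> E' \<Longrightarrow> f u v = h v - h u" by blast
    have main: "\<exists>h. (\<forall>(u, v)\<in>E'. f u v = h v - h u) \<and> f a b = h b - h a"
    proof (cases "(a, b) \<in> E'\<^sup>*")
      case True
      then obtain p where p: "p \<noteq> []" "hd p = a" "last p = b" "distinct p" "set (vwalk_arcs p) \<subseteq> E'"
        by (rule rtrancl_imp_distinct_path)
      \<comment> \<open>One vertex would mean \<open>a = b\<close>, and two vertices would mean that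
        the path uses the removed edge.\<close>
      have "3 \<le> length p"
      proof (rule ccontr)
        assume "\<not> 3 \<le> length p"
        with p(1) consider x where "p = [x]" | x y where "p = [x, y]"
          by (cases p rule: vwalk_arcs.cases) (auto simp: not_le less_Suc_eq numeral_3_eq_3)
        then show False
          using p(2,3,5) \<open>a \<noteq> b\<close> by cases (auto simp: E'_def)
      qed
      then have "cycle_sum f p = 0"
        using p sub ba by (intro less.prems(5)) auto
      moreover have "path_sum f p = path_sum (\<lambda>u v. h v - h u) p"
        using p(5) h by (intro path_sum_cong) auto
      ultimately have "f a b = h b - h a"
        using p less.prems(4)[OF ab] by (simp add: cycle_sum_def path_sum_potential)
      with h show ?thesis by blast
    next
      case False
      \<comment> \<open>\<open>c\<close> is the error of \<open>h\<close> on the removed edge. Since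
        \<open>b\<close> lies outside the component of \<open>a\<close>, lowering \<open>h\<close>
        by \<open>c\<close> on that component corrects it. Edges of \<open>E'\<close> never leave
        the component because \<open>E'\<close> is symmetric.\<close>
      define c where "c = f a b - (h b - h a)"
      define h' where "h' = (\<lambda>v. if (a, v) \<in> E'\<^sup>* then h v - c else h v)"
      have "f u v = h' v - h' u" if "(u, v) \<in> E'" for u v
      proof -
        have "(a, u) \<in> E'\<^sup>* \<longleftrightarrow> (a, v) \<in> E'\<^sup>*"
          using that sym' by (meson rtrancl.rtrancl_into_rtrancl symD)
        then show ?thesis using h[OF that] by (simp add: h'_def)
      qed
      moreover have "f a b = h' b - h' a"
        using False by (simp add: h'_def c_def)
      ultimately show ?thesis by blast
    qed
    then obtain h where h: "\<And>u v. (u, v) \<in> E' \<Longrightarrow> f u v = h v - h u" "f a b = h b - h a" by blast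
    have "f u v = h v - h u" if "(u, v) \<in> E" for u v
    proof -
      consider "(u, v) \<in> E'" | "u = a" "v = b" | "u = b" "v = a"
        using \<open>(u, v) \<in> E\<close> by (auto simp: E'_def)
      then show ?thesis
        using h less.prems(4)[OF ab] by cases auto
    qed
    then show ?thesis by blast
  qed simp
qed


section \<open>Descents of a linear ordering\<close>

definition descent :: "'a list \<Rightarrow> 'a \<Rightarrow> 'a \<Rightarrow> int" where
  "descent xs u v = of_bool (position xs v < position xs u)"

lemma position_less_length: "distinct xs \<Longrightarrow> a \<in> set xs \<Longrightarrow> position xs a < length xs"
  and nth_position: "distinct xs \<Longrightarrow> a \<in> set xs \<Longrightarrow> xs ! position xs a = a"
  using position_less_length_and_nth by metis+

lemma position_append:
  assumes "distinct (xs @ ys)" "a \<in> set (xs @ ys)"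
  shows "position (xs @ ys) a =
    (if a \<in> set xs then position xs a else length xs + position ys a)"
  using assms
  by (intro position_eqI) (auto simp: nth_append position_less_length nth_position trans_less_add1)

lemma position_Cons:
  assumes "distinct (x # xs)" "a \<in> set (x # xs)"
  shows "position (x # xs) a = (if a = x then 0 else Suc (position xs a))"
  using assms by (intro position_eqI) (auto simp: position_less_length nth_position)

lemma position_eq_iff:
  assumes "distinct xs" "a \<in> set xs" "b \<in> set xs"
  shows "position xs a = position xs b \<longleftrightarrow> a = b"
  using assms by (metis nth_position)

lemma descent_antisym:
  assumes "distinct xs" "u \<in> set xs" "v \<in> set xs" "u \<noteq> v"
  shows "descent xs v u = 1 - descent xs u v"
  using position_eq_iff[OF assms(1-3)] assms(4) by (auto simp: descent_def)

text \<open>The wrap-around summand of \<open>theta_list\<close> occurs exactly at a descent. In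
  this form without \<open>mod\<close> the identity can be summed along a cycle, where the position
  terms telescope.\<close>

lemma theta_list_eq_descent:
  assumes "distinct xs" "a \<in> set xs" "b \<in> set xs"
  shows "int (theta_list xs a b) =
    int (position xs b) - int (position xs a) + int (length xs) * descent xs a b"
  using position_less_length[OF assms(1,2)] position_less_length[OF assms(1,3)]
  by (auto simp: theta_list_def descent_def Let_def)

lemma descent_same [simp]: "descent xs u u = 0"
  by (simp add: descent_def)

lemma descent_append:
  assumes "distinct (xs @ ys)" "u \<in> set (xs @ ys)" "v \<in> set (xs @ ys)"
  shows "descent (xs @ ys) u v =
    (if u \<in> set xs then if v \<in> set xs then descent xs u v else 0
     else if v \<in> set xs then 1 else descent ys u v)"
  using assms position_less_length[of xs u] position_less_length[of xs v]
    position_append[OF assms(1,2)] position_append[OF assms(1,3)]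
  by (auto simp: descent_def)

lemma descent_Cons:
  assumes "distinct (x # xs)" "u \<in> set (x # xs)" "v \<in> set (x # xs)"
  shows "descent (x # xs) u v =
    (if u = x then 0 else if v = x then 1 else descent xs u v)"
  using position_Cons[OF assms(1,2)] position_Cons[OF assms(1,3)]
  by (auto simp: descent_def)

lemma descent_swap:
  assumes "distinct (ps @ a # b # xs)" "u \<in> set (ps @ a # b # xs)" "v \<in> set (ps @ a # b # xs)"
    and "(u, v) \<noteq> (a, b)" "(u, v) \<noteq> (b, a)"
  shows "descent (ps @ a # b # xs) u v = descent (ps @ b # a # xs) u v"
proof -
  have "distinct (ps @ b # a # xs)" using assms(1) by auto
  then show ?thesis
    using assms by (auto simp: descent_append descent_Cons)
qed


section \<open>Wiggles of linear representatives\<close>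

text \<open>The cyclic shift is a move of its own, so swaps across the end of the list arise by
  rotating first.\<close>

inductive list_wiggle :: "('a \<times> 'a) set \<Rightarrow> 'a list \<Rightarrow> 'a list \<Rightarrow> bool" for E where
  swap: "(a, b) \<notin> E \<Longrightarrow> list_wiggle E (ps @ a # b # xs) (ps @ b # a # xs)"
| rotate: "list_wiggle E xs (rotate1 xs)"

text \<open>\<open>y\<close> passes the entries of \<open>xs\<close> from the last to the first,
  hence the reverse induction.\<close>

lemma list_wiggle_move_left:
  assumes "\<And>x. x \<in> set xs \<Longrightarrow> (x, y) \<notin> E"
  shows "(list_wiggle E)\<^sup>*\<^sup>* (ps @ xs @ y # ys) (ps @ y # xs @ ys)"
  using assms
proof (induction xs arbitrary: ys rule: rev_induct)
  case (snoc x xs)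
  have "list_wiggle E ((ps @ xs) @ x # y # ys) ((ps @ xs) @ y # x # ys)"
    using snoc.prems by (intro list_wiggle.swap) simp
  moreover have "(list_wiggle E)\<^sup>*\<^sup>* (ps @ xs @ y # x # ys) (ps @ y # xs @ x # ys)"
    using snoc.prems by (intro snoc.IH) simp
  ultimately show ?case by (simp add: converse_rtranclp_into_rtranclp)
qed simp

text \<open>Linear extensions of the same acyclic orientation differ by swaps alone.\<close>

lemma list_wiggle_same_orientation:
  assumes "distinct xs" "distinct ys" "set xs = set ys"
    and "\<And>u v. u \<in> set xs \<Longrightarrow> v \<in> set xs \<Longrightarrow> (u, v) \<in> E \<Longrightarrow> descent xs u v = descent ys u v"
  shows "(list_wiggle E)\<^sup>*\<^sup>* (ps @ xs) (ps @ ys)"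
  using assms
proof (induction ys arbitrary: xs ps)
  case (Cons y ys)
  then obtain as bs where xs: "xs = as @ y # bs"
    by (metis in_set_conv_decomp list.set_intros(1))
  have dist: "distinct (as @ y # bs)" and sets: "set as \<union> set bs = set ys"
    using Cons.prems(1-3) xs by auto
  \<comment> \<open>An edge from \<open>x\<close> to \<open>y\<close> would be a descent in
    \<open>y # ys\<close>, where \<open>y\<close> comes first, but not in \<open>xs\<close>, where
    \<open>x\<close> precedes \<open>y\<close>.\<close>
  have "(x, y) \<notin> E" if "x \<in> set as" for x
  proof
    assume "(x, y) \<in> E"
    then have "descent xs x y = descent (y # ys) x y"
      using that xs by (intro Cons.prems(4)) auto
    moreover have "descent xs x y = 0" "descent (y # ys) x y = 1"
      using that xs dist sets[symmetric] Cons.prems(2) by (auto simp: descent_append descent_Cons)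
    ultimately show False by simp
  qed
  then have "(list_wiggle E)\<^sup>*\<^sup>* (ps @ xs) ((ps @ [y]) @ as @ bs)"
    using list_wiggle_move_left[of as y E ps bs] xs by simp
  \<comment> \<open>Once in place, \<open>y\<close> joins the fixed prefix, and the induction
    hypothesis sorts the rest.\<close>
  also have "(list_wiggle E)\<^sup>*\<^sup>* \<dots> ((ps @ [y]) @ ys)"
  proof (rule Cons.IH)
    fix u v assume uv: "u \<in> set (as @ bs)" "v \<in> set (as @ bs)" "(u, v) \<in> E"
    then have "descent xs u v = descent (y # ys) u v"
      using xs by (intro Cons.prems(4)) auto
    moreover have "descent xs u v = descent (as @ bs) u v"
      using uv dist xs by (auto simp: descent_append descent_Cons)
    moreover have "descent (y # ys) u v = descent ys u v"
      using uv sets dist Cons.prems(2) by (auto simp: descent_Cons)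
    ultimately show "descent (as @ bs) u v = descent ys u v" by simp
  qed (use dist sets Cons.prems(2) in auto)
  finally show ?case by simp
qed simp

text \<open>
  The first maximizer \<open>s\<close> of the potential \<open>h\<close> precedes all of its neighbours in \<open>xs\<close>, hence can
  be moved to the front and then to the end, which lowers \<open>h s\<close> by one and nothing else.
\<close>

lemma list_wiggle_potential:
  fixes h :: "'a \<Rightarrow> int"
  assumes "distinct xs" "distinct ys" "set xs = set ys" "sym E" "irrefl E"
    and "\<And>v. v \<in> set xs \<Longrightarrow> 0 \<le> h v"
    and "\<And>u v. u \<in> set xs \<Longrightarrow> v \<in> set xs \<Longrightarrow> (u, v) \<in> E \<Longrightarrow>
      descent xs u v - descent ys u v = h v - h u"
  shows "(list_wiggle E)\<^sup>*\<^sup>* xs ys"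
  using assms
proof (induction "\<Sum>v\<in>set xs. nat (h v)" arbitrary: xs h rule: less_induct)
  case (less xs h)
  show ?case
  proof (cases "\<forall>v\<in>set xs. h v = 0")
    case True
    then have "(list_wiggle E)\<^sup>*\<^sup>* ([] @ xs) ([] @ ys)"
      using less.prems by (intro list_wiggle_same_orientation) auto
    then show ?thesis by simp
  next
    case False
    define M where "M = Max (h ` set xs)"
    have le_M: "h v \<le> M" if "v \<in> set xs" for v
      using that by (simp add: M_def)
    have "M \<in> h ` set xs"
      unfolding M_def using False by (intro Max_in) auto
    then have "\<exists>s\<in>set xs. h s = M" by auto
    then obtain as s bs where xs: "xs = as @ s # bs" and s: "h s = M" and
      as: "\<forall>x\<in>set as. h x \<noteq> M"
      by (rule split_list_first_propE)
    \<comment> \<open>Positivity of the integer \<open>M\<close> lets \<open>h s\<close> be lowered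
      by one while staying nonnegative.\<close>
    have "0 < M"
    proof -
      from False obtain v where "v \<in> set xs" "h v \<noteq> 0" by blast
      then show ?thesis using le_M[of v] less.prems(6)[of v] by linarith
    qed
    have dist: "distinct (as @ s # bs)" using less.prems(1) xs by simp
    \<comment> \<open>On such an edge the difference of descents is \<open>- descent ys x s\<close>,
      hence at most 0, whereas \<open>h s - h x\<close> is positive because \<open>s\<close> is the
      first maximizer.\<close>
    have nbr: "(x, s) \<notin> E" if "x \<in> set as" for x
    proof
      assume "(x, s) \<in> E"
      then have "descent xs x s - descent ys x s = h s - h x"
        using that xs by (intro less.prems(7)) auto
      moreover have "descent xs x s = 0"
        using that xs dist by (auto simp: descent_append descent_Cons)
      moreover have "h x < h s"
        using that xs as s le_M[of x] by fastforce
      moreover have "0 \<le> descent ys x s"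
        by (simp add: descent_def)
      ultimately show False by linarith
    qed
    define xs' where "xs' = (as @ bs) @ [s]"
    define h' where "h' = h(s := M - 1)"
    have set_xs': "set xs' = set xs" by (auto simp: xs'_def xs)
    have "(list_wiggle E)\<^sup>*\<^sup>* xs (s # as @ bs)"
      using list_wiggle_move_left[of as s E "[]" bs] nbr xs by simp
    also have "list_wiggle E (s # as @ bs) xs'"
      using list_wiggle.rotate[of E "s # as @ bs"] by (simp add: xs'_def)
    also have "(list_wiggle E)\<^sup>*\<^sup>* xs' ys"
    proof (rule less.hyps)
      have "(\<Sum>v\<in>set xs. nat (h' v)) < (\<Sum>v\<in>set xs. nat (h v))"
        using \<open>0 < M\<close> s xs by (intro sum_strict_mono_ex1) (auto simp: h'_def)
      then show "(\<Sum>v\<in>set xs'. nat (h' v)) < (\<Sum>v\<in>set xs. nat (h v))"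
        by (simp add: set_xs')
      show "0 \<le> h' v" if "v \<in> set xs'" for v
        using that less.prems(6) \<open>0 < M\<close> by (auto simp: h'_def set_xs')
      show "descent xs' u v - descent ys u v = h' v - h' u"
        if uv: "u \<in> set xs'" "v \<in> set xs'" "(u, v) \<in> E" for u v
      proof -
        have old: "descent xs u v - descent ys u v = h v - h u"
          using uv set_xs' by (intro less.prems(7)) auto
        have dist': "distinct xs'" using dist by (auto simp: xs'_def)
        have "u \<noteq> v" using uv less.prems(5) by (auto simp: irrefl_def)
        have "(v, u) \<in> E" using uv less.prems(4) by (auto simp: sym_def)
        \<comment> \<open>All neighbours of \<open>s\<close> lie in \<open>bs\<close>, so the move
          flips the descent of every edge at \<open>s\<close>. The change by one, of either sign, is
          the one that lowering \<open>h s\<close> causes on the right. Edges away from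
          \<open>s\<close> keep both sides.\<close>
        consider "u = s" "v \<in> set bs" | "v = s" "u \<in> set bs"
          | "u \<in> set (as @ bs)" "v \<in> set (as @ bs)"
          using uv set_xs' nbr \<open>(v, u) \<in> E\<close> \<open>u \<noteq> v\<close> by (auto simp: xs)
        then show ?thesis
        proof cases
          case 1
          then have "descent xs u v = 0" "descent xs' u v = 1"
            using dist dist' by (auto simp: xs xs'_def descent_append descent_Cons)
          then show ?thesis using old 1 s \<open>u \<noteq> v\<close> by (simp add: h'_def)
        next
          case 2
          then have "descent xs u v = 1" "descent xs' u v = 0"
            using dist dist' by (auto simp: xs xs'_def descent_append descent_Cons)
          then show ?thesis using old 2 s \<open>u \<noteq> v\<close> by (simp add: h'_def)
        next
          case 3
          then have "descent xs u v = descent xs' u v"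
            using dist dist' by (auto simp: xs xs'_def descent_append descent_Cons)
          then show ?thesis using old 3 dist by (auto simp: h'_def)
        qed
      qed
    qed (use less.prems set_xs' dist in \<open>auto simp: xs'_def\<close>)
    finally show ?thesis .
  qed
qed


section \<open>Wiggles and winding numbers of cyclic orderings\<close>

lemma cyclic_orderings_cases:
  assumes "\<sigma> \<in> cyclic_orderings V"
  obtains xs where "xs \<in> permutations_of_set V" "\<sigma> = cyclic_shift `` {xs}"
  using assms by (auto simp: cyclic_orderings_def quotient_def)

lemma cyclic_orderingsI:
  "xs \<in> permutations_of_set V \<Longrightarrow> cyclic_shift `` {xs} \<in> cyclic_orderings V"
  by (auto simp: cyclic_orderings_def quotient_def)

lemma rotate_in_cyclic_shift: "rotate k xs \<in> cyclic_shift `` {xs}"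
  by (auto simp: cyclic_shift_def)

lemma self_in_cyclic_shift: "xs \<in> cyclic_shift `` {xs}"
  using rotate_in_cyclic_shift[of 0 xs] by simp

lemma mem_cyclic_ordering:
  assumes "\<sigma> \<in> cyclic_orderings V" "xs \<in> \<sigma>"
  shows "distinct xs" "set xs = V"
  using assms by (auto elim!: cyclic_orderings_cases simp: cyclic_shift_def permutations_of_set_def)

lemma cyclic_shift_rotate1: "cyclic_shift `` {rotate1 xs} = cyclic_shift `` {xs}"
proof (cases "xs = []")
  case False
  have fwd: "rotate k (rotate1 xs) = rotate (Suc k) xs" for k
    by (simp add: rotate1_rotate_swap)
  \<comment> \<open>Completing a full turn undoes the extra rotation; the list is nonempty, so the
    truncated subtraction is exact.\<close>
  have "rotate k xs = rotate (k + length xs - 1) (rotate1 xs)" for k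
  proof -
    have "rotate (k + length xs - 1) (rotate1 xs) = rotate (k + length xs) xs"
      using False unfolding fwd by (cases xs) auto
    also have "\<dots> = rotate k xs"
      by (metis mod_add_self2 rotate_conv_mod)
    finally show ?thesis by simp
  qed
  with fwd show ?thesis unfolding cyclic_shift_def by (auto; metis)
qed simp

text \<open>A swap behind a prefix \<open>ps\<close> becomes a swap of the first two entries after
  both lists are rotated by \<open>length ps\<close>; a rotation leaves the class unchanged. The
  permutation property is carried along because \<open>wiggle\<close> demands cyclic orderings on
  both sides.\<close>

lemma wiggle_equivalent_of_list_wiggle:
  assumes "(list_wiggle (arcs_ends (underlying_graph Q)))\<^sup>*\<^sup>* xs ys"
    and "xs \<in> permutations_of_set (verts Q)"
  shows "ys \<in> permutations_of_set (verts Q) \<and>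
    wiggle_equivalent Q (cyclic_shift `` {xs}) (cyclic_shift `` {ys})"
  using assms
proof (induction rule: rtranclp_induct)
  case base
  then show ?case by (simp add: wiggle_equivalent_def)
next
  case (step ys zs)
  then have ys: "ys \<in> permutations_of_set (verts Q)" and
    "wiggle_equivalent Q (cyclic_shift `` {xs}) (cyclic_shift `` {ys})" by auto
  moreover from \<open>list_wiggle _ ys zs\<close> have "zs \<in> permutations_of_set (verts Q)"
    using ys by cases (auto simp: permutations_of_set_def)
  moreover from \<open>list_wiggle _ ys zs\<close>
  have "(wiggle Q)\<^sup>*\<^sup>* (cyclic_shift `` {ys}) (cyclic_shift `` {zs})"
  proof cases
    case (swap a b ps rs)
    have "a # b # rs @ ps \<in> cyclic_shift `` {ys}" "b # a # rs @ ps \<in> cyclic_shift `` {zs}"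
      using rotate_in_cyclic_shift[of "length ps" ys] rotate_in_cyclic_shift[of "length ps" zs]
      by (simp_all add: swap rotate_append)
    then have "wiggle Q (cyclic_shift `` {ys}) (cyclic_shift `` {zs})"
      using swap(3) cyclic_orderingsI[OF ys] cyclic_orderingsI[OF \<open>zs \<in> _\<close>]
      unfolding wiggle_def by blast
    then show ?thesis by blast
  next
    case rotate
    then show ?thesis by (simp add: cyclic_shift_rotate1)
  qed
  ultimately show ?case by (auto simp: wiggle_equivalent_def)
qed

section \<open>Cycles of the underlying graph and their winding numbers\<close>

lemma arcs_ends_underlying_graph:
  "arcs_ends (underlying_graph Q) = arcs_ends Q \<union> (arcs_ends Q)\<inverse>"
  by (auto simp: underlying_graph_def mk_symmetric_def arcs_ends_conv)

lemma undirected_cycle_underlying_graph: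
  "undirected_cycle (underlying_graph Q) us \<longleftrightarrow>
    3 \<le> length us \<and> set us \<subseteq> verts Q \<and> distinct us \<and>
    set (vwalk_arcs us) \<subseteq> arcs_ends (underlying_graph Q) \<and>
    (last us, hd us) \<in> arcs_ends (underlying_graph Q)"
  by (auto simp: undirected_cycle_def vpath_def vwalk_def underlying_graph_def)

text \<open>The position terms cancel around the cycle and leave \<open>n\<close> times the number
  of descents. The factor \<open>n\<close> can be divided out because a nonempty \<open>us\<close>
  provides a vertex.\<close>

lemma wind_eq_cycle_sum_descent:
  assumes "\<sigma> \<in> cyclic_orderings (verts Q)" "xs \<in> \<sigma>" "set us \<subseteq> verts Q" "us \<noteq> []"
  shows "wind Q us \<sigma> = of_int (cycle_sum (descent xs) us) -
    of_nat (card {i. i < length us \<and> us ! ((i + 1) mod length us) \<rightarrow>\<^bsub>Q\<^esub> us ! (i mod length us)})"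
proof -
  let ?k = "length us" and ?u = "\<lambda>i. us ! (i mod length us)"
  let ?p = "\<lambda>v. int (position xs v)"
  have xs: "distinct xs" "set xs = verts Q"
    using mem_cyclic_ordering[OF assms(1,2)] .
  have n: "card (verts Q) = length xs"
    using xs by (metis distinct_card)
  have n0: "length xs \<noteq> 0"
    using assms(3,4) xs by auto
  have k0: "0 < ?k" using assms(4) by simp
  have u: "?u i \<in> verts Q" for i
    using assms(3) k0 by (meson mod_less_divisor nth_mem subsetD)
  have th: "int (theta \<sigma> (?u i) (?u (i + 1))) =
      (?p (?u (i + 1)) - ?p (?u i)) + int (length xs) * descent xs (?u i) (?u (i + 1))" for i
    using theta_eq_theta_list[OF assms(1,2) u u] theta_list_eq_descent[of xs] xs u by simp
  \<comment> \<open>Indices are taken modulo the length, so the telescoping sum ends at the vertex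
    where it began.\<close>
  have tel: "(\<Sum>i<?k. ?p (?u (i + 1)) - ?p (?u i)) = 0"
    using sum_lessThan_telescope[of "\<lambda>i. ?p (?u i)" ?k] k0 by simp
  have "int (\<Sum>i<?k. theta \<sigma> (?u i) (?u (i + 1))) =
      int (length xs) * (\<Sum>i<?k. descent xs (?u i) (?u (i + 1)))"
    using tel by (simp only: of_nat_sum th sum.distrib sum_distrib_left)
  also have "(\<Sum>i<?k. descent xs (?u i) (?u (i + 1))) =
      (\<Sum>i<?k. descent xs (us ! i) (us ! ((i + 1) mod ?k)))"
    by (intro sum.cong) auto
  also have "\<dots> = cycle_sum (descent xs) us"
    using assms(4) by (rule cycle_sum_nth)
  finally have "rat_of_int (int (\<Sum>i<?k. theta \<sigma> (?u i) (?u (i + 1)))) =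
      rat_of_int (int (length xs) * cycle_sum (descent xs) us)" by simp
  then have "rat_of_nat (\<Sum>i<?k. theta \<sigma> (?u i) (?u (i + 1))) =
      of_nat (length xs) * of_int (cycle_sum (descent xs) us)"
    by (simp only: of_int_of_nat_eq of_int_mult)
  then show ?thesis
    using n0 unfolding wind_def Let_def n by simp
qed

text \<open>The subtracted cardinality depends on \<open>Q\<close> and \<open>us\<close> alone, so
  it cancels.\<close>

lemma wind_eq_iff:
  assumes "\<sigma> \<in> cyclic_orderings (verts Q)" "xs \<in> \<sigma>"
    and "\<sigma>' \<in> cyclic_orderings (verts Q)" "ys \<in> \<sigma>'"
    and "set us \<subseteq> verts Q" "us \<noteq> []"
  shows "wind Q us \<sigma> = wind Q us \<sigma>' \<longleftrightarrow>
    cycle_sum (descent xs) us = cycle_sum (descent ys) us"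
  using assms by (simp add: wind_eq_cycle_sum_descent)

text \<open>Suitable representatives differ by exchanging their first two entries. This affects only
  the descents between \<open>a\<close> and \<open>b\<close>, and no step of the cycle joins these
  two, as they are not adjacent.\<close>

lemma wiggle_imp_wind_eq:
  assumes "wiggle Q \<sigma> \<sigma>'" "undirected_cycle (underlying_graph Q) us"
  shows "wind Q us \<sigma> = wind Q us \<sigma>'"
proof -
  let ?E = "arcs_ends (underlying_graph Q)"
  from assms(1) obtain a b xs where \<sigma>: "\<sigma> \<in> cyclic_orderings (verts Q)" "a # b # xs \<in> \<sigma>"
    and \<sigma>': "\<sigma>' \<in> cyclic_orderings (verts Q)" "b # a # xs \<in> \<sigma>'" and ab: "(a, b) \<notin> ?E"
    unfolding wiggle_def by blast
  have ba: "(b, a) \<notin> ?E"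
    using ab by (auto simp: arcs_ends_underlying_graph)
  have us: "set us \<subseteq> verts Q" "us \<noteq> []" "set (vwalk_arcs us) \<subseteq> ?E" "(last us, hd us) \<in> ?E"
    using assms(2) by (auto simp: undirected_cycle_underlying_graph)
  have "cycle_sum (descent (a # b # xs)) us = cycle_sum (descent (b # a # xs)) us"
  proof (rule cycle_sum_cong)
    fix u v assume uv: "(u, v) \<in> insert (last us, hd us) (set (vwalk_arcs us))"
    then have "(u, v) \<in> ?E" using us by auto
    moreover have "u \<in> verts Q" "v \<in> verts Q"
      using uv us in_set_vwalk_arcsE[of u v us] by auto
    ultimately show "descent (a # b # xs) u v = descent (b # a # xs) u v"
      using descent_swap[of "[]" a b xs u v] mem_cyclic_ordering[OF \<sigma>] ab ba by auto
  qed
  then show ?thesis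
    using wind_eq_iff[OF \<sigma> \<sigma>' us(1,2)] by simp
qed

theorem theorem2p14:
  fixes Q :: "('a, 'b) pre_digraph" and \<sigma> \<sigma>' :: "'a list set"
  assumes "quiver Q"
    and "\<sigma> \<in> cyclic_orderings (verts Q)"
    and "\<sigma>' \<in> cyclic_orderings (verts Q)"
  shows "wiggle_equivalent Q \<sigma> \<sigma>' \<longleftrightarrow>
    (\<forall>C. undirected_cycle (underlying_graph Q) C \<longrightarrow> wind Q C \<sigma> = wind Q C \<sigma>')"
proof
  assume "wiggle_equivalent Q \<sigma> \<sigma>'"
  then have "(wiggle Q)\<^sup>*\<^sup>* \<sigma> \<sigma>'"
    by (simp add: wiggle_equivalent_def)
  then show "\<forall>C. undirected_cycle (underlying_graph Q) C \<longrightarrow> wind Q C \<sigma> = wind Q C \<sigma>'"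
    by induction (auto simp: wiggle_imp_wind_eq)
next
  assume wind: "\<forall>C. undirected_cycle (underlying_graph Q) C \<longrightarrow> wind Q C \<sigma> = wind Q C \<sigma>'"
  interpret quiver Q by fact
  define E where "E = arcs_ends (underlying_graph Q)"
  have E_verts: "u \<in> verts Q" "v \<in> verts Q" if "(u, v) \<in> E" for u v
    using that by (auto simp: E_def arcs_ends_underlying_graph)
  have "finite E"
    unfolding E_def arcs_ends_underlying_graph by (simp add: arcs_ends_def)
  have "sym E"
    by (auto simp: E_def arcs_ends_underlying_graph sym_def)
  have "irrefl E"
    by (auto simp: E_def arcs_ends_underlying_graph irrefl_def dest: adj_not_same)
  obtain xs ys where xs: "xs \<in> permutations_of_set (verts Q)" "\<sigma> = cyclic_shift `` {xs}"
    and ys: "ys \<in> permutations_of_set (verts Q)" "\<sigma>' = cyclic_shift `` {ys}"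
    using assms(2,3) by (elim cyclic_orderings_cases)
  have xs': "distinct xs" "set xs = verts Q" and ys': "distinct ys" "set ys = verts Q"
    using xs ys by (auto simp: permutations_of_set_def)
  have mem: "xs \<in> \<sigma>" "ys \<in> \<sigma>'"
    using xs ys self_in_cyclic_shift by auto
  define f where "f = (\<lambda>u v. descent xs u v - descent ys u v)"
  have "\<exists>h. \<forall>(u, v)\<in>E. f u v = h v - h u"
  proof (rule conservative_imp_potential)
    fix u v assume "(u, v) \<in> E"
    moreover from this have "u \<noteq> v" using \<open>irrefl E\<close> by (auto simp: irrefl_def)
    \<comment> \<open>Reversing a step turns a descent indicator \<open>d\<close> into
      \<open>1 - d\<close>; the constant cancels in the difference of the two orderings.\<close>
    ultimately show "f v u = - f u v"
      using descent_antisym[of xs u v] descent_antisym[of ys u v] xs' ys' E_verts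
      by (simp add: f_def)
  next
    fix us assume us: "3 \<le> length us" "distinct us" "set (vwalk_arcs us) \<subseteq> E" "(last us, hd us) \<in> E"
    have "set us \<subseteq> verts Q"
    proof
      fix v assume "v \<in> set us"
      then obtain ps qs where "us = ps @ v # qs" by (auto simp: in_set_conv_decomp)
      \<comment> \<open>\<open>v\<close> is the tail of the next step, or of the closing edge if it
        comes last.\<close>
      then show "v \<in> verts Q"
        using us(3,4) E_verts set_vwalk_arcs_append2[of "v # qs" ps] by (cases qs) auto
    qed
    moreover from this us have "undirected_cycle (underlying_graph Q) us"
      by (simp add: undirected_cycle_underlying_graph E_def)
    moreover have "us \<noteq> []" using us(1) by auto
    ultimately have "cycle_sum (descent xs) us = cycle_sum (descent ys) us"
      using wind_eq_iff[OF assms(2) mem(1) assms(3) mem(2)] wind by blast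
    then show "cycle_sum f us = 0"
      by (simp add: f_def cycle_sum_diff)
  qed fact+
  then obtain h where h: "\<And>u v. (u, v) \<in> E \<Longrightarrow> f u v = h v - h u" by blast
  \<comment> \<open>Subtracting a constant keeps all differences; the minimum makes the values
    nonnegative, as \<open>list_wiggle_potential\<close> requires.\<close>
  define h' where "h' = (\<lambda>v. h v - Min (h ` set xs))"
  have "(list_wiggle E)\<^sup>*\<^sup>* xs ys"
  proof (rule list_wiggle_potential[where h = h'])
    show "0 \<le> h' v" if "v \<in> set xs" for v
      using that by (simp add: h'_def)
    show "descent xs u v - descent ys u v = h' v - h' u" if "(u, v) \<in> E" for u v
      using h[OF that] by (simp add: h'_def f_def)
  qed (use xs' ys' \<open>sym E\<close> \<open>irrefl E\<close> in auto)
  then show "wiggle_equivalent Q \<sigma> \<sigma>'"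
    using wiggle_equivalent_of_list_wiggle[of Q xs ys] xs ys by (simp add: E_def)
qed

end
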